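(* For every integer $k\geq 3$, $$\log_2\bigl(bl(k)+1\bigr) \;\leq\; \beta(k) \;\leq\; \min\left\{ 20\sqrt{\log_2 k}\,\log_2\log_2 k,\ bl(k) + 1 \right\}.$$
   Context: A DNF formula is a disjunction of terms (conjunctions of literals) and a CNF formula is a conjunction of clauses (disjunctions of literals), over a finite set of Boolean variables; the satisfying assignments are counted among all truth assignments to this variable set, which may include variables not occurring in the formula. For a positive integer $k$, $\beta(k)$ is the minimum number of terms or clauses of a DNF or CNF formula having exactly $k$ satisfying assignments. The block binary representation of a positive integer $k$ is the unique way of writing its binary representation as $\mathbf{1}_{q_b}\mathbf{0}_{l_b}\cdots\mathbf{1}_{q_2}\mathbf{0}_{l_2}\mathbf{1}_{q_1}\mathbf{0}_{l_1}$, where $\mathbf{1}_q$ (resp. $\mathbf{0}_l$) denotes a string of $q$ ones (resp. $l$ zeros), $q_i>0$ for all $i\in[b]$, $l_j>0$ for all $j\in[2,b]$, and $l_1\geq 0$; the block count of $k$ is $bl(k)=b$ (the number of maximal runs of consecutive 1's). *)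

theory Defs
  imports Complex_Main "HOL-Library.FuncSet"
begin

section \<open>DNF and CNF formulas\<close>

datatype literal = Pos nat | Neg nat

primrec var :: "literal \<Rightarrow> nat" where
  "var (Pos x) = x"
| "var (Neg x) = x"

primrec holds :: "(nat \<Rightarrow> bool) \<Rightarrow> literal \<Rightarrow> bool" where
  "holds a (Pos x) \<longleftrightarrow> a x"
| "holds a (Neg x) \<longleftrightarrow> \<not> a x"

text \<open>
  A set of sets of literals is read either as a DNF (the inner sets being terms) or as a CNF
  (the inner sets being clauses). A formula has at least one term or clause: the empty
  conjunction would otherwise give all powers of two with zero clauses.
\<close>

definition formula_over :: "nat set \<Rightarrow> literal set set \<Rightarrow> bool" where
  "formula_over V F \<longleftrightarrow> finite F \<and> F \<noteq> {} \<and> (\<forall>C\<in>F. var ` C \<subseteq> V)"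

definition sat_dnf :: "(nat \<Rightarrow> bool) \<Rightarrow> literal set set \<Rightarrow> bool" where
  "sat_dnf a F \<longleftrightarrow> (\<exists>C\<in>F. \<forall>l\<in>C. holds a l)"

definition sat_cnf :: "(nat \<Rightarrow> bool) \<Rightarrow> literal set set \<Rightarrow> bool" where
  "sat_cnf a F \<longleftrightarrow> (\<forall>C\<in>F. \<exists>l\<in>C. holds a l)"

definition assignments :: "nat set \<Rightarrow> (nat \<Rightarrow> bool) set" where
  "assignments V = V \<rightarrow>\<^sub>E UNIV"

definition \<beta> :: "nat \<Rightarrow> nat" where
  "\<beta> k = (LEAST m. \<exists>V F. finite V \<and> formula_over V F \<and> card F = m \<and>
      (card {a \<in> assignments V. sat_dnf a F} = k \<or>
       card {a \<in> assignments V. sat_cnf a F} = k))"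

section \<open>Block binary representation\<close>

text \<open>
  The pairs \<open>(q, l)\<close> are listed from the most significant block to the least significant one,
  so only the last \<open>l\<close> may be zero.
\<close>

definition block_string :: "(nat \<times> nat) list \<Rightarrow> bool list" where
  "block_string bs = concat (map (\<lambda>(q, l). replicate q True @ replicate l False) bs)"

definition block_rep :: "nat \<Rightarrow> (nat \<times> nat) list \<Rightarrow> bool" where
  "block_rep k bs \<longleftrightarrow>
     (\<forall>(q, l)\<in>set bs. q > 0) \<and> (\<forall>(q, l)\<in>set (butlast bs). l > 0) \<and>
     horner_sum of_bool 2 (rev (block_string bs)) = k"

definition bl :: "nat \<Rightarrow> nat" where
  "bl k = length (THE bs. block_rep k bs)"

end

theory Submission imports Defs "HOL-Library.Nat_Bijection" begin

text \<open>
  Lower bound: by inclusion-exclusion a DNF with \<open>m\<close> terms has a signed sum of \<open>2^m - 1\<close> powers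
  of two as its model count. Adding or subtracting a power of two changes the number of
  transitions between adjacent bits by at most two, and \<open>k\<close> has \<open>2 * bl k\<close> transitions. For a CNF
  one subtracts from \<open>2^n\<close>; that extra summand is free, as \<open>2^n - 2^j\<close> still has only two transitions.

  Upper bound by \<open>bl k + 1\<close>: terms are subcubes. Appending a block of \<open>q\<close> ones and \<open>l\<close> zeros to \<open>K\<close>
  yields \<open>K * 2^(q+l) + 2^(q+l) - 2^l\<close>, so it costs one new subcube of size \<open>2^(q+l)\<close> that meets
  the old union in \<open>2^l\<close> points, all of them in the most recent subcube.

  Square root bound: take \<open>s\<close> pairwise disjoint subcubes \<open>A i\<close> and \<open>s\<close> pairwise disjoint subcubes \<open>B j\<close>,
  where \<open>A i\<close> and \<open>B j\<close> either conflict or meet in \<open>2^(i*s+j)\<close> points. Choosing the conflicts freely, the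
  union has \<open>S - D\<close> points for a fixed \<open>S\<close> and an arbitrary \<open>D < 2^(s*s)\<close>; with \<open>s\<close> about the square root of
  \<open>log 2 k\<close> this produces all but the leading \<open>O(s)\<close> bits of \<open>k\<close>, which are added one term each.
\<close>

section \<open>Subcubes and realizable numbers\<close>

text \<open>Only the values of \<open>f\<close> on \<open>W\<close> matter. In this encoding every
  term is consistent, so a subcube over \<open>W \<subseteq> V\<close> is never empty.\<close>

definition subcube :: "'v set \<Rightarrow> 'v set \<Rightarrow> ('v \<Rightarrow> bool) \<Rightarrow> ('v \<Rightarrow> bool) set" where
  "subcube V W f = {a \<in> V \<rightarrow>\<^sub>E UNIV. \<forall>v\<in>W. a v = f v}"

definition cubes :: "'v set \<Rightarrow> ('v set \<times> ('v \<Rightarrow> bool)) set \<Rightarrow> ('v \<Rightarrow> bool) set" where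
  "cubes V C = (\<Union>(W, f)\<in>C. subcube V W f)"

lemma card_subcube:
  assumes "finite V" "W \<subseteq> V"
  shows "card (subcube V W f) = 2 ^ card (V - W)"
proof -
  have "subcube V W f = (\<Pi>\<^sub>E v\<in>V. if v \<in> W then {f v} else UNIV)"
    using assms(2) by (auto simp: subcube_def PiE_iff extensional_def split: if_splits)
  also have "card \<dots> = (\<Prod>v\<in>V. if v \<in> W then 1 else 2)"
    using assms(1) by (simp add: card_PiE if_distrib cong: if_cong)
  also have "\<dots> = 2 ^ card (V - W)"
    using assms by (simp add: prod.If_cases Diff_eq)
  finally show ?thesis .
qed

lemma finite_subcube [simp]: "finite V \<Longrightarrow> finite (subcube V W f)"
  unfolding subcube_def by (simp add: finite_PiE)

lemma finite_cubes [simp]: "finite V \<Longrightarrow> finite (cubes V C)"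
  by (rule finite_subset[of _ "V \<rightarrow>\<^sub>E UNIV"]) (auto simp: cubes_def subcube_def finite_PiE)

lemma subcube_cong:
  "(\<And>v. v \<in> W \<Longrightarrow> f v = g v) \<Longrightarrow> subcube V W f = subcube V W g"
  by (auto simp: subcube_def)

lemma subcube_Int:
  assumes "\<And>v. v \<in> W \<Longrightarrow> v \<in> W' \<Longrightarrow> f v = f' v"
  shows "subcube V W f \<inter> subcube V W' f' = subcube V (W \<union> W') (\<lambda>v. if v \<in> W then f v else f' v)"
  using assms by (auto simp: subcube_def)

lemma subcube_disjoint:
  assumes "v \<in> W" "v \<in> W'" "f v \<noteq> f' v"
  shows "subcube V W f \<inter> subcube V W' f' = {}"
  using assms by (auto simp: subcube_def)

lemma cubes_Un: "cubes V (C \<union> D) = cubes V C \<union> cubes V D"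
  by (auto simp: cubes_def)

lemma cubes_insert: "cubes V (insert (W, f) C) = subcube V W f \<union> cubes V C"
  by (auto simp: cubes_def)

text \<open>The set splits into the fibres of restriction to \<open>V\<close>. Each fibre is a
  subcube fixing \<open>V\<close> and \<open>R\<close>, and distinct fibres differ at some variable
  of \<open>V\<close>. With \<open>R\<close> empty this scales a count by a power of two; with
  \<open>R\<close> all the new variables it preserves the count.\<close>

lemma card_extensions:
  assumes "finite V'" "V \<subseteq> V'" "R \<subseteq> V'" "V \<inter> R = {}" "S \<subseteq> V \<rightarrow>\<^sub>E UNIV"
  shows "card {a \<in> V' \<rightarrow>\<^sub>E UNIV. restrict a V \<in> S \<and> (\<forall>v\<in>R. a v)} = card S * 2 ^ card (V' - V - R)"
proof -
  let ?c = "\<lambda>b. subcube V' (V \<union> R) (\<lambda>v. if v \<in> V then b v else True)"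
  have finV: "finite V" using assms finite_subset by blast
  have finS: "finite S"
    by (rule finite_subset[OF assms(5)]) (simp add: finV finite_PiE)
  have eq: "{a \<in> V' \<rightarrow>\<^sub>E UNIV. restrict a V \<in> S \<and> (\<forall>v\<in>R. a v)} = (\<Union>b\<in>S. ?c b)"
  proof (intro equalityI subsetI)
    fix a assume "a \<in> {a \<in> V' \<rightarrow>\<^sub>E UNIV. restrict a V \<in> S \<and> (\<forall>v\<in>R. a v)}"
    then have "restrict a V \<in> S" "a \<in> ?c (restrict a V)"
      by (auto simp: subcube_def)
    then show "a \<in> (\<Union>b\<in>S. ?c b)" by blast
  next
    fix a assume "a \<in> (\<Union>b\<in>S. ?c b)"
    then obtain b where b: "b \<in> S" "a \<in> ?c b" by blast
    have "restrict a V = b"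
    proof
      fix v show "restrict a V v = b v"
        using b assms(5) by (cases "v \<in> V") (auto simp: subcube_def PiE_iff extensional_def)
    qed
    moreover have "\<forall>v\<in>R. a v" using b assms(4) by (auto simp: subcube_def)
    ultimately show "a \<in> {a \<in> V' \<rightarrow>\<^sub>E UNIV. restrict a V \<in> S \<and> (\<forall>v\<in>R. a v)}"
      using b by (auto simp: subcube_def)
  qed
  have "card (\<Union>b\<in>S. ?c b) = (\<Sum>b\<in>S. card (?c b))"
  proof (rule card_UN_disjoint[OF finS])
    show "\<forall>b\<in>S. finite (?c b)" using assms(1) by simp
    show "\<forall>b\<in>S. \<forall>b'\<in>S. b \<noteq> b' \<longrightarrow> ?c b \<inter> ?c b' = {}"
    proof (intro ballI impI)
      fix b b' assume "b \<in> S" "b' \<in> S" "b \<noteq> b'"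
      then obtain v where "v \<in> V" "b v \<noteq> b' v"
        using PiE_ext[of b V "\<lambda>_. UNIV" b'] assms(5) by blast
      then show "?c b \<inter> ?c b' = {}" by (intro subcube_disjoint[of v]) auto
    qed
  qed
  also have "\<dots> = card S * 2 ^ card (V' - V - R)"
    using assms by (simp add: card_subcube Diff_eq Int_assoc)
  finally show ?thesis using eq by simp
qed

lemma card_cubes_extend:
  assumes "finite V'" "V \<subseteq> V'" "\<And>W f. (W, f) \<in> C \<Longrightarrow> W \<subseteq> V"
  shows "card (cubes V' C) = card (cubes V C) * 2 ^ card (V' - V)"
proof -
  have "cubes V' C = {a \<in> V' \<rightarrow>\<^sub>E UNIV. restrict a V \<in> cubes V C \<and> (\<forall>v\<in>{}. a v)}"
  proof -
    have iff: "a \<in> subcube V' W f \<longleftrightarrow> a \<in> V' \<rightarrow>\<^sub>E UNIV \<and> restrict a V \<in> subcube V W f"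
      if "(W, f) \<in> C" for a W f
      using assms(3)[OF that] by (auto simp: subcube_def)
    show ?thesis
    proof (rule set_eqI)
      fix a
      have "a \<in> cubes V' C \<longleftrightarrow> (\<exists>x\<in>C. a \<in> subcube V' (fst x) (snd x))"
        by (simp add: cubes_def case_prod_beta)
      also have "\<dots> \<longleftrightarrow> (\<exists>x\<in>C. a \<in> V' \<rightarrow>\<^sub>E UNIV \<and> restrict a V \<in> subcube V (fst x) (snd x))"
        by (rule bex_cong[OF refl], rule iff) simp
      also have "\<dots> \<longleftrightarrow> a \<in> {a \<in> V' \<rightarrow>\<^sub>E UNIV. restrict a V \<in> cubes V C \<and> (\<forall>v\<in>{}. a v)}"
        by (simp only: cubes_def case_prod_beta mem_Collect_eq UN_iff) blast
      finally show "a \<in> cubes V' C \<longleftrightarrow> \<dots>" .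
    qed
  qed
  also have "card \<dots> = card (cubes V C) * 2 ^ card (V' - V - {})"
    by (rule card_extensions) (use assms in \<open>auto simp: cubes_def subcube_def\<close>)
  finally show ?thesis by simp
qed

text \<open>The bound \<open>card C \<le> m\<close> instead of an equation makes the notion monotone
  in \<open>m\<close>. It also absorbs pairs that coincide after a translation.\<close>

definition realizable :: "nat \<Rightarrow> nat \<Rightarrow> bool" where
  "realizable k m \<longleftrightarrow> (\<exists>(V :: nat set) C. finite V \<and> finite C \<and> card C \<le> m \<and>
     (\<forall>(W, f)\<in>C. W \<subseteq> V) \<and> card (cubes V C) = k)"

text \<open>Renaming variables along an injection preserves the number of points, so constructions
  may use any convenient variable type, such as the pairs of the grid below.\<close>

lemma realizableI:
  fixes h :: "'v \<Rightarrow> nat" and V :: "'v set"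
  assumes "inj h" "finite V" "finite C" "card C \<le> m" "\<And>W f. (W, f) \<in> C \<Longrightarrow> W \<subseteq> V"
  shows "realizable (card (cubes V C)) m"
proof -
  let ?t = "\<lambda>(W, f). (h ` W, f \<circ> inv h)"
  let ?r = "\<lambda>a :: nat \<Rightarrow> bool. restrict (a \<circ> h) V"
  have inv: "inv h (h v) = v" for v using assms(1) by simp
  have bij: "bij_betw ?r (cubes (h ` V) (?t ` C)) (cubes V C)"
  proof (rule bij_betw_imageI)
    have "h ` V \<rightarrow>\<^sub>E UNIV \<supseteq> cubes (h ` V) (?t ` C)"
      by (auto simp: cubes_def subcube_def)
    moreover have "inj_on ?r (h ` V \<rightarrow>\<^sub>E UNIV)"
    proof (rule inj_onI)
      fix a b :: "nat \<Rightarrow> bool"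
      assume ab: "a \<in> h ` V \<rightarrow>\<^sub>E UNIV" "b \<in> h ` V \<rightarrow>\<^sub>E UNIV" "?r a = ?r b"
      show "a = b"
      proof (rule PiE_ext[OF ab(1,2)])
        fix x assume "x \<in> h ` V"
        then obtain v where "v \<in> V" "x = h v" by blast
        with fun_cong[OF ab(3), of v] show "a x = b x" by simp
      qed
    qed
    ultimately show "inj_on ?r (cubes (h ` V) (?t ` C))" by (rule inj_on_subset[rotated])
    show "?r ` cubes (h ` V) (?t ` C) = cubes V C"
    proof (intro equalityI subsetI)
      fix b assume "b \<in> ?r ` cubes (h ` V) (?t ` C)"
      then obtain W f a where "(W, f) \<in> C" "a \<in> subcube (h ` V) (h ` W) (f \<circ> inv h)" "b = ?r a"
        by (auto simp: cubes_def)
      moreover from this have "b \<in> subcube V W f"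
        using assms(5) by (auto simp: subcube_def inv)
      ultimately show "b \<in> cubes V C" by (auto simp: cubes_def)
    next
      fix b assume "b \<in> cubes V C"
      then obtain W f where Wf: "(W, f) \<in> C" "b \<in> subcube V W f"
        by (auto simp: cubes_def)
      define a where "a = restrict (b \<circ> inv h) (h ` V)"
      have "W \<subseteq> V" using assms(5) Wf(1) by blast
      then have "a \<in> subcube (h ` V) (h ` W) (f \<circ> inv h)"
        using Wf(2) by (auto simp: subcube_def a_def inv)
      then have "a \<in> cubes (h ` V) (?t ` C)" using Wf(1) by (force simp: cubes_def)
      moreover have "?r a = b"
        using Wf(2) by (auto simp: a_def inv subcube_def restrict_def fun_eq_iff PiE_iff extensional_def)
      ultimately show "b \<in> ?r ` cubes (h ` V) (?t ` C)" by blast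
    qed
  qed
  show ?thesis
    unfolding realizable_def
  proof (rule exI[of _ "h ` V"], rule exI[of _ "?t ` C"], intro conjI)
    show "finite (h ` V)" "finite (?t ` C)" using assms by auto
    show "card (?t ` C) \<le> m" using card_image_le[OF assms(3)] assms(4) le_trans by blast
    show "\<forall>(W, f)\<in>?t ` C. W \<subseteq> h ` V" using assms(5) by fastforce
    show "card (cubes (h ` V) (?t ` C)) = card (cubes V C)" by (rule bij_betw_same_card[OF bij])
  qed
qed

lemma realizable_mono: "realizable k m \<Longrightarrow> m \<le> m' \<Longrightarrow> realizable k m'"
  unfolding realizable_def by (elim exE, rule exI, rule exI) (auto elim: le_trans)

lemma fresh_set:
  fixes V :: "nat set"
  assumes "finite V"
  obtains R where "finite R" "card R = n" "R \<inter> V = {}"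
  using infinite_arbitrarily_large[of "- V" n] assms by (auto simp: finite_compl)

text \<open>Forcing all fresh variables \<open>R\<close> to true in the old cubes keeps their count
  \<open>k\<close>. The new cube sets one \<open>g \<in> R\<close> to false, hence is disjoint from
  them; it also fixes \<open>V\<close> and leaves the rest of \<open>R\<close> open.\<close>

lemma realizable_add_power:
  assumes "realizable k m"
  shows "realizable (k + 2 ^ j) (Suc m)"
proof -
  obtain V :: "nat set" and C where VC: "finite V" "finite C" "card C \<le> m"
    "\<And>W f. (W, f) \<in> C \<Longrightarrow> W \<subseteq> V" "card (cubes V C) = k"
    using assms unfolding realizable_def by fast
  \<comment> \<open>One variable more than \<open>j\<close>, because \<open>g\<close> is spent on
    separating the new cube from the old ones.\<close>
  obtain R where R: "finite R" "card R = Suc j" "R \<inter> V = {}"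
    using fresh_set[OF VC(1)] by blast
  then obtain g where g: "g \<in> R" by fastforce
  let ?V = "V \<union> R"
  let ?t = "\<lambda>(W, f). (W \<union> R, \<lambda>v. if v \<in> V then f v else True)"
  let ?T = "subcube ?V (insert g V) (\<lambda>_. False)"
  have "cubes ?V (?t ` C) = {a \<in> ?V \<rightarrow>\<^sub>E UNIV. restrict a V \<in> cubes V C \<and> (\<forall>v\<in>R. a v)}"
  proof -
    have iff: "a \<in> subcube ?V (W \<union> R) (\<lambda>v. if v \<in> V then f v else True) \<longleftrightarrow>
        a \<in> ?V \<rightarrow>\<^sub>E UNIV \<and> restrict a V \<in> subcube V W f \<and> (\<forall>v\<in>R. a v)"
      if "(W, f) \<in> C" for a W f
    proof -
      have "W \<subseteq> V" using VC(4)[OF that] .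
      then have "(\<forall>v\<in>W. a v = (if v \<in> V then f v else True)) \<longleftrightarrow> (\<forall>v\<in>W. restrict a V v = f v)"
        by (auto simp: subset_eq)
      moreover have "(\<forall>v\<in>R. a v = (if v \<in> V then f v else True)) \<longleftrightarrow> (\<forall>v\<in>R. a v)"
        using R(3) by auto
      ultimately show ?thesis unfolding subcube_def by (simp add: ball_Un)
    qed
    show ?thesis
    proof (rule set_eqI)
      fix a
      have "a \<in> cubes ?V (?t ` C) \<longleftrightarrow>
          (\<exists>x\<in>C. a \<in> subcube ?V (fst x \<union> R) (\<lambda>v. if v \<in> V then snd x v else True))"
        by (simp add: cubes_def case_prod_beta)
      also have "\<dots> \<longleftrightarrow>
          (\<exists>x\<in>C. a \<in> ?V \<rightarrow>\<^sub>E UNIV \<and> restrict a V \<in> subcube V (fst x) (snd x) \<and> (\<forall>v\<in>R. a v))"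
        by (rule bex_cong[OF refl], rule iff) simp
      also have "\<dots> \<longleftrightarrow> a \<in> {a \<in> ?V \<rightarrow>\<^sub>E UNIV. restrict a V \<in> cubes V C \<and> (\<forall>v\<in>R. a v)}"
        by (simp only: cubes_def case_prod_beta mem_Collect_eq UN_iff) blast
      finally show "a \<in> cubes ?V (?t ` C) \<longleftrightarrow> \<dots>" .
    qed
  qed
  also have "card \<dots> = card (cubes V C) * 2 ^ card (?V - V - R)"
    by (rule card_extensions) (use VC R in \<open>auto simp: cubes_def subcube_def\<close>)
  also have "?V - V - R = {}" by blast
  finally have k: "card (cubes ?V (?t ` C)) = k" using VC(5) by simp
  have "?V - insert g V = R - {g}" using R(3) by auto
  then have T: "card ?T = 2 ^ j"
    using VC(1) R g by (subst card_subcube) auto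
  have disj: "?T \<inter> cubes ?V (?t ` C) = {}"
    using g R(3) by (auto simp: cubes_def subcube_def)
  have "realizable (card (cubes ?V (insert (insert g V, \<lambda>_. False) (?t ` C)))) (Suc m)"
  proof (rule realizableI)
    show "inj (id :: nat \<Rightarrow> nat)" by simp
    show "card (insert (insert g V, \<lambda>_. False) (?t ` C)) \<le> Suc m"
      using card_image_le[OF VC(2), of ?t] VC(2,3) by (simp add: card_insert_if)
    show "W \<subseteq> ?V" if "(W, f) \<in> insert (insert g V, \<lambda>_. False) (?t ` C)" for W f
      using that g VC(4) by auto
  qed (use VC R in auto)
  then show ?thesis
    using k T disj VC(1) R(1) by (simp add: cubes_insert card_Un_disjoint add.commute)
qed

text \<open>Every binary digit one of \<open>e\<close> costs one cube; the induction strips the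
  leading digit.\<close>

lemma realizable_add:
  assumes "realizable k m" "e < 2 ^ r"
  shows "realizable (k + e * 2 ^ c) (m + r)"
  using assms(2)
proof (induction r arbitrary: e)
  case 0
  then show ?case using assms(1) by simp
next
  case (Suc r)
  show ?case
  proof (cases "e < 2 ^ r")
    case True
    then show ?thesis using Suc.IH realizable_mono by fastforce
  next
    case False
    then have "realizable (k + (e - 2 ^ r) * 2 ^ c) (m + r)" using Suc by simp
    then have "realizable (k + (e - 2 ^ r) * 2 ^ c + 2 ^ (r + c)) (Suc (m + r))"
      by (rule realizable_add_power)
    moreover have "k + (e - 2 ^ r) * 2 ^ c + 2 ^ (r + c) = k + ((e - 2 ^ r) + 2 ^ r) * 2 ^ c"
      by (simp only: power_add distrib_right add.assoc)
    ultimately show ?thesis using False by simp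
  qed
qed

section \<open>Translation of subcubes into DNF terms\<close>

definition cube_term :: "nat set \<times> (nat \<Rightarrow> bool) \<Rightarrow> literal set" where
  "cube_term = (\<lambda>(W, f). (\<lambda>v. if f v then Pos v else Neg v) ` W)"

lemma realizable_dnf:
  assumes "realizable k m" "k > 0"
  shows "\<exists>V F. finite V \<and> formula_over V F \<and> card F \<le> m \<and> card {a \<in> assignments V. sat_dnf a F} = k"
proof -
  obtain V :: "nat set" and C where VC: "finite V" "finite C" "card C \<le> m"
    "\<And>W f. (W, f) \<in> C \<Longrightarrow> W \<subseteq> V" "card (cubes V C) = k"
    using assms(1) unfolding realizable_def by fast
  have holds: "(\<forall>l\<in>cube_term x. holds a l) \<longleftrightarrow> (\<forall>v\<in>fst x. a v = snd x v)" for x a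
  proof -
    have "holds a (if f v then Pos v else Neg v) \<longleftrightarrow> a v = f v" for f v by simp
    then show ?thesis by (simp only: cube_term_def case_prod_beta ball_simps)
  qed
  have "{a \<in> assignments V. sat_dnf a (cube_term ` C)} = cubes V C"
  proof (rule set_eqI)
    fix a
    have "sat_dnf a (cube_term ` C) \<longleftrightarrow> (\<exists>x\<in>C. \<forall>v\<in>fst x. a v = snd x v)"
      by (simp add: sat_dnf_def holds)
    then show "a \<in> {a \<in> assignments V. sat_dnf a (cube_term ` C)} \<longleftrightarrow> a \<in> cubes V C"
      by (simp add: cubes_def subcube_def case_prod_beta assignments_def)
  qed
  \<comment> \<open>This is where \<open>k > 0\<close> enters: \<open>formula_over\<close> demands
    at least one term.\<close>
  moreover have "C \<noteq> {}" using VC(5) assms(2) by (simp add: cubes_def) fastforce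
  moreover have "formula_over V (cube_term ` C)"
  proof -
    have "var (if f v then Pos v else Neg v) = v" for f v by simp
    then have "var ` cube_term x = fst x" for x
      unfolding cube_term_def case_prod_beta image_image by (simp only: image_ident)
    then show ?thesis
      using VC(2,4) \<open>C \<noteq> {}\<close> by (simp add: formula_over_def) (metis prod.collapse)
  qed
  moreover have "card (cube_term ` C) \<le> m"
    using card_image_le[OF VC(2), of cube_term] VC(3) by linarith
  ultimately show ?thesis using VC(1,5) by (intro exI[of _ V] exI[of _ "cube_term ` C"]) simp
qed

section \<open>The upper bound by the block count\<close>

text \<open>
  \<open>(L, h)\<close> is the most recent cube. The values of \<open>h\<close> on \<open>N\<close> rule out all earlier cubes, so a new cube
  prescribing \<open>h\<close> on \<open>N\<close> can only meet \<open>L\<close>; the \<open>B\<close> variables in \<open>L - N\<close> leave room for blocks of up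
  to \<open>B\<close> ones.
\<close>

definition cube_chain :: "nat \<Rightarrow> nat \<Rightarrow> nat \<Rightarrow> bool" where
  "cube_chain K m B \<longleftrightarrow> (\<exists>(V :: nat set) C L N h. finite V \<and> finite C \<and> Suc (card C) \<le> m \<and>
     (\<forall>(W, f)\<in>C. W \<subseteq> V \<and> (\<exists>v\<in>W \<inter> N. f v \<noteq> h v)) \<and> L \<subseteq> V \<and> N \<subseteq> V \<and>
     B \<le> card (L - N) \<and> card (cubes V (insert (L, h) C)) = K)"

lemma realizable_cube_chain:
  assumes "cube_chain K m B" shows "realizable K m"
proof -
  obtain V :: "nat set" and C L N h where *: "finite V" "finite C" "Suc (card C) \<le> m"
    "\<forall>(W, f)\<in>C. W \<subseteq> V \<and> (\<exists>v\<in>W \<inter> N. f v \<noteq> h v)" "L \<subseteq> V"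
    "card (cubes V (insert (L, h) C)) = K"
    using assms unfolding cube_chain_def by blast
  have "realizable (card (cubes V (insert (L, h) C))) m"
    by (rule realizableI[of id]) (use * in \<open>auto simp: card_insert_if\<close>)
  then show ?thesis using * by simp
qed

text \<open>The fresh variables \<open>R\<close> and \<open>S\<close> scale the old union by
  \<open>2 ^ (q + l)\<close>. The cube \<open>T\<close> leaves \<open>Q\<close> and \<open>S\<close>
  open, so it has that many points too. It agrees with \<open>h\<close> on \<open>N\<close>, which
  excludes every cube of \<open>C\<close>; its intersection with the cube of \<open>L\<close> leaves
  only \<open>S\<close> open.\<close>

lemma cube_chain_step:
  assumes "cube_chain K m B" "0 < q" "q \<le> B"
  shows "cube_chain (K * 2 ^ (q + l) + (2 ^ q - 1) * 2 ^ l) (Suc m) B"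
proof -
  obtain V :: "nat set" and C L N h where VC: "finite V" "finite C" "Suc (card C) \<le> m"
    "L \<subseteq> V" "N \<subseteq> V" "B \<le> card (L - N)" "card (cubes V (insert (L, h) C)) = K"
    and C: "\<forall>(W, f)\<in>C. W \<subseteq> V \<and> (\<exists>v\<in>W \<inter> N. f v \<noteq> h v)"
    using assms(1) unfolding cube_chain_def by blast
  have CV: "W \<subseteq> V" and CN: "\<exists>v\<in>W \<inter> N. f v \<noteq> h v" if "(W, f) \<in> C" for W f
    using C that by auto
  have "q \<le> card (L - N)" using assms(3) VC(6) by simp
  then obtain Q where Q: "Q \<subseteq> L - N" "card Q = q" "finite Q"
    by (rule obtain_subset_with_card_n)
  then obtain v0 where v0: "v0 \<in> Q" using assms(2) by fastforce
  obtain R where R: "finite R" "card R = q" "R \<inter> V = {}" using fresh_set[OF VC(1)] by blast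
  obtain S where S: "finite S" "card S = l" "S \<inter> (V \<union> R) = {}"
    using fresh_set[of "V \<union> R"] VC(1) R(1) by blast
  \<comment> \<open>The new cube \<open>T\<close> leaves \<open>Q\<close> open; flipping \<open>v0 \<in> Q\<close> in \<open>h\<close> makes later cubes avoid \<open>L\<close>.\<close>
  define V' where "V' = V \<union> R \<union> S"
  define T where "T = (V - Q) \<union> R"
  define h' where "h' = h(v0 := \<not> h v0)"
  define C' where "C' = insert (L, h) C"
  have finV': "finite V'" using VC R S by (simp add: V'_def)
  have VV': "V \<subseteq> V'" by (auto simp: V'_def)
  have cardC': "card C' \<le> m" using VC(2,3) by (simp add: C'_def card_insert_if)
  have C'V: "W \<subseteq> V" if "(W, f) \<in> C'" for W f
    using that CV VC(4) by (auto simp: C'_def)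
  \<comment> \<open>Older cubes keep the disagreement they had, as \<open>v0\<close> lies outside
    \<open>N\<close>; the cube \<open>(L, h)\<close> gets its disagreement at
    \<open>v0 \<in> L\<close>.\<close>
  have N': "\<exists>v\<in>W \<inter> insert v0 N. f v \<noteq> h' v" if "(W, f) \<in> C'" for W f
  proof (cases "(W, f) \<in> C")
    case True
    then obtain v where "v \<in> W \<inter> N" "f v \<noteq> h v" using CN by blast
    moreover from this have "v \<noteq> v0" using Q(1) v0 by blast
    ultimately show ?thesis by (auto simp: h'_def)
  next
    case False
    then show ?thesis using that v0 Q(1) by (auto simp: C'_def h'_def)
  qed
  \<comment> \<open>\<open>T\<close> gives up the \<open>q\<close> variables of \<open>Q\<close> but
    gains the \<open>q\<close> variables of \<open>R\<close>, so the room for later blocks does not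
    shrink.\<close>
  have B: "B \<le> card (T - insert v0 N)"
  proof -
    have "card (L - N) \<le> card ((V - N - Q) \<union> Q)"
      by (rule card_mono) (use VC Q in auto)
    also have "\<dots> \<le> card (V - N - Q) + q" using card_Un_le[of "V - N - Q" Q] Q(2) by simp
    also have "\<dots> = card ((V - N - Q) \<union> R)"
      using VC(1) R by (subst card_Un_disjoint) auto
    also have "(V - N - Q) \<union> R = T - insert v0 N"
      using R(3) VC(5) v0 Q(1) VC(4) by (auto simp: T_def)
    finally show ?thesis using VC(6) by simp
  qed
  \<comment> \<open>Since \<open>v0\<close> is open in \<open>T\<close>, the new cube may be
    recorded with \<open>h'\<close>, as the chain invariant requires, without changing it.\<close>
  have T: "subcube V' T h' = subcube V' T h"
  proof (rule subcube_cong)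
    fix v assume "v \<in> T"
    then have "v \<noteq> v0" using v0 Q(1) VC(4) R(3) by (auto simp: T_def)
    then show "h' v = h v" by (simp add: h'_def)
  qed
  have "V' - T = Q \<union> S" using Q(1) VC(4) R(3) S(3) by (auto simp: V'_def T_def)
  moreover have "card (Q \<union> S) = q + l"
    using Q VC(4) S by (subst card_Un_disjoint) auto
  ultimately have cardT: "card (subcube V' T h) = 2 ^ (q + l)"
    using card_subcube[OF finV', of T h] by (simp add: V'_def T_def Diff_subset le_supI1)
  have "V' - V = R \<union> S" using R(3) S(3) by (auto simp: V'_def)
  moreover have "card (R \<union> S) = q + l" using R S by (subst card_Un_disjoint) auto
  moreover have "card (cubes V' C') = card (cubes V C') * 2 ^ card (V' - V)"
    by (rule card_cubes_extend[OF finV' VV']) (rule C'V)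
  ultimately have cardC: "card (cubes V' C') = K * 2 ^ (q + l)"
    using VC(7) by (simp add: C'_def)
  have disj: "subcube V' T h \<inter> subcube V' W f = {}" if WC: "(W, f) \<in> C" for W f
  proof -
    obtain v where v: "v \<in> W \<inter> N" "f v \<noteq> h v" using CN[OF WC] by blast
    then have "v \<in> T" using VC(5) Q(1) by (auto simp: T_def)
    then show ?thesis by (rule subcube_disjoint) (use v in auto)
  qed
  have "subcube V' T h \<inter> cubes V' C' = subcube V' T h \<inter> subcube V' L h"
    using disj by (fastforce simp: C'_def cubes_def)
  also have "\<dots> = subcube V' (T \<union> L) (\<lambda>v. if v \<in> T then h v else h v)"
    by (rule subcube_Int) simp
  finally have Int: "subcube V' T h \<inter> cubes V' C' = subcube V' (T \<union> L) h" by simp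
  have "V' - (T \<union> L) = S" using Q(1) VC(4) S(3) by (auto simp: V'_def T_def)
  then have cardInt: "card (subcube V' T h \<inter> cubes V' C') = 2 ^ l"
    unfolding Int using card_subcube[OF finV', of "T \<union> L" h] S(2) VC(4)
    by (auto simp: V'_def T_def)
  have "card (cubes V' (insert (T, h') C')) + 2 ^ l = K * 2 ^ (q + l) + 2 ^ (q + l)"
    using card_Un_Int[of "subcube V' T h" "cubes V' C'"] finV'
    by (simp add: cubes_insert T cardInt cardT cardC)
  moreover have "(2 ^ q - 1) * 2 ^ l + 2 ^ l = (2 ^ (q + l) :: nat)"
    by (simp add: power_add diff_mult_distrib)
  ultimately have K': "card (cubes V' (insert (T, h') C')) = K * 2 ^ (q + l) + (2 ^ q - 1) * 2 ^ l"
    by linarith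
  have "\<forall>(W, f)\<in>C'. W \<subseteq> V' \<and> (\<exists>v\<in>W \<inter> insert v0 N. f v \<noteq> h' v)"
    using C'V N' by (fastforce simp: V'_def)
  moreover have "T \<subseteq> V'" "insert v0 N \<subseteq> V'"
    using VC(4,5) v0 Q(1) by (auto simp: V'_def T_def)
  moreover have "finite C'" using VC(2) by (simp add: C'_def)
  moreover have "Suc (card C') \<le> Suc m" using cardC' by simp
  ultimately show ?thesis
    unfolding cube_chain_def using finV' B K'
    by (intro exI[of _ V'] exI[of _ C'] exI[of _ T] exI[of _ "insert v0 N"] exI[of _ h']) simp
qed

lemma cube_chain_base:
  assumes "0 < m"
  shows "cube_chain (2 ^ l) m B"
proof -
  have "{..<B + l} - {..<B} = {B..<B + l}" by auto
  then have "card (cubes {..<B + l} (insert ({..<B}, \<lambda>_. True) {})) = 2 ^ l"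
    by (simp add: cubes_def card_subcube)
  then show ?thesis
    unfolding cube_chain_def
    by (intro exI[of _ "{..<B + l}"] exI[of _ "{}"] exI[of _ "{..<B}"] exI[of _ "\<lambda>_. True"])
      (use assms in simp)
qed

text \<open>The leading one is a single cube and the other \<open>q - 1\<close> ones are appended by
  one step. The first block may thus cost two cubes, which is the source of the \<open>+ 1\<close>
  in the upper bound.\<close>

lemma cube_chain_block:
  assumes "0 < q" "q \<le> B"
  shows "cube_chain ((2 ^ q - 1) * 2 ^ l) 2 B"
proof (cases "q = 1")
  case True
  then show ?thesis using cube_chain_base[of 2 l B] by simp
next
  case False
  with assms obtain p where p: "q = Suc p" "0 < p" by (cases q) auto
  have "cube_chain (2 ^ 0 * 2 ^ (p + l) + (2 ^ p - 1) * 2 ^ l) (Suc 1) B"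
    by (rule cube_chain_step[OF cube_chain_base]) (use p assms in auto)
  moreover have "2 ^ 0 * 2 ^ (p + l) + (2 ^ p - 1) * 2 ^ l = (2 ^ q - 1) * (2 ^ l :: nat)"
    by (simp add: p power_add diff_mult_distrib)
  ultimately show ?thesis by (simp add: numeral_2_eq_2)
qed

section \<open>Values of block lists\<close>

definition block_value :: "(nat \<times> nat) list \<Rightarrow> nat" where
  "block_value bs = horner_sum of_bool 2 (rev (block_string bs))"

lemma horner_sum_replicate_True: "horner_sum of_bool 2 (replicate q True) = (2 ^ q - 1 :: nat)"
proof -
  have "horner_sum of_bool 2 (replicate q True) + 1 = (2 ^ q :: nat)"
    by (induction q) auto
  then show ?thesis by simp
qed

lemma horner_sum_replicate_False: "horner_sum of_bool 2 (replicate l False) = (0 :: nat)"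
  by (induction l) auto

lemma block_value_Nil: "block_value [] = 0"
  by (simp add: block_value_def block_string_def)

lemma block_value_snoc:
  "block_value (bs @ [(q, l)]) = block_value bs * 2 ^ (q + l) + (2 ^ q - 1) * 2 ^ l"
  by (simp add: block_value_def block_string_def horner_sum_append horner_sum_replicate_True
      horner_sum_replicate_False power_add algebra_simps)

lemma cube_chain_block_value:
  assumes "bs \<noteq> []" "\<forall>(q, l)\<in>set bs. 0 < q \<and> q \<le> B"
  shows "cube_chain (block_value bs) (length bs + 1) B"
  using assms
proof (induction bs rule: rev_induct)
  case (snoc x bs)
  obtain q l where x: "x = (q, l)" by fastforce
  show ?case
  proof (cases "bs = []")
    case True
    then show ?thesis
      using cube_chain_block[of q B l] snoc.prems x block_value_snoc[of "[]" q l]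
      by (simp add: block_value_Nil numeral_2_eq_2)
  next
    case False
    then have "cube_chain (block_value bs) (length bs + 1) B" using snoc by auto
    from cube_chain_step[OF this, of q l] show ?thesis
      using snoc.prems x by (simp add: block_value_snoc)
  qed
qed simp

section \<open>Bit transitions\<close>

text \<open>
  The number of positions in the two's complement of \<open>z\<close> where adjacent bits differ, with a zero
  appended at the least significant end. A block of ones contributes two.
\<close>

function transitions :: "int \<Rightarrow> nat" where
  "transitions z = (if z = 0 then 0 else if z = - 1 then 1
     else transitions (z div 2) + (if odd z \<and> even (z div 2) then 2 else 0))"
  by auto
termination by (relation "measure (\<lambda>z. nat \<bar>z\<bar>)") auto

declare transitions.simps [simp del]

lemma transitions_0 [simp]: "transitions 0 = 0"
  by (subst transitions.simps) simp

lemma transitions_double: "transitions (2 * z) = transitions z"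
proof -
  have "2 * z \<noteq> - 1" by presburger
  then show ?thesis by (cases "z = 0") (simp_all add: transitions.simps[of "2 * z"])
qed

lemma transitions_double_Suc: "transitions (2 * z + 1) = transitions z + (if even z then 2 else 0)"
proof -
  have "2 * z + 1 \<noteq> 0" by presburger
  then show ?thesis
    by (cases "z = - 1") (simp_all add: transitions.simps[of "2 * z + 1"] transitions.simps[of "- 1"])
qed

text \<open>The parity of \<open>z\<close> fixes the direction of the change. At odd
  \<open>z\<close> the halved number and the last boundary change together; knowing the direction
  lets the two changes offset each other, which a plain bound by two would not.\<close>

lemma transitions_succ:
  "if even z then transitions z \<le> transitions (z + 1) \<and> transitions (z + 1) \<le> transitions z + 2
   else transitions (z + 1) \<le> transitions z \<and> transitions z \<le> transitions (z + 1) + 2"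
proof (induction z rule: transitions.induct)
  case (1 z)
  show ?case
  proof (cases "even z")
    case True
    then obtain w where "z = 2 * w" by blast
    then show ?thesis by (simp add: transitions_double transitions_double_Suc)
  next
    case False
    then obtain w where w: "z = 2 * w + 1" by (rule oddE)
    have eq: "transitions (z + 1) = transitions (w + 1)"
      using transitions_double[of "w + 1"] by (simp add: w algebra_simps)
    show ?thesis
    proof (cases "z = - 1")
      case True
      then show ?thesis by (simp add: transitions.simps[of "- 1"])
    next
      case False
      then have "if even w then transitions w \<le> transitions (w + 1) \<and> transitions (w + 1) \<le> transitions w + 2
         else transitions (w + 1) \<le> transitions w \<and> transitions w \<le> transitions (w + 1) + 2"
        using 1 \<open>odd z\<close> w by fastforce
      then show ?thesis
        using \<open>odd z\<close> unfolding eq by (auto simp: w transitions_double_Suc split: if_splits)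
    qed
  qed
qed

lemma transitions_add_power:
  "transitions (z + 2 ^ j) \<le> transitions z + 2 \<and> transitions z \<le> transitions (z + 2 ^ j) + 2"
proof (induction j arbitrary: z)
  case 0
  then show ?case using transitions_succ[of z] by (auto split: if_splits)
next
  case (Suc j)
  show ?case
  proof (cases "even z")
    case True
    then obtain w where w: "z = 2 * w" by blast
    have "z + 2 ^ Suc j = 2 * (w + 2 ^ j)" by (simp add: w)
    then show ?thesis using Suc.IH[of w] by (simp only: w transitions_double)
  next
    case False
    then obtain w where w: "z = 2 * w + 1" by (rule oddE)
    have eq: "z + 2 ^ Suc j = 2 * (w + 2 ^ j) + 1" by (simp add: w)
    show ?thesis
    \<comment> \<open>Only for \<open>j = 0\<close> does the addition flip the parity of
      \<open>w\<close>, and with it the boundary below \<open>w\<close>. The directions in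
      \<open>transitions_succ\<close> keep the total change within two.\<close>
    proof (cases "j = 0")
      case True
      have e: "transitions (z + 2 ^ Suc j) = transitions (w + 1) + (if even (w + 1) then 2 else 0)"
        unfolding eq unfolding True power_0 by (rule transitions_double_Suc)
      show ?thesis
        unfolding e unfolding w transitions_double_Suc
        using transitions_succ[of w] by (cases "even w") simp_all
    next
      case False
      have e: "transitions (z + 2 ^ Suc j) = transitions (w + 2 ^ j) + (if even w then 2 else 0)"
        unfolding eq transitions_double_Suc using False by simp
      show ?thesis
        unfolding e unfolding w transitions_double_Suc using Suc.IH[of w] by simp
    qed
  qed
qed

text \<open>Each summand costs at most two, a negative one by the reverse inequality of
  \<open>transitions_add_power\<close>. Zero summands will arise from empty intersections.\<close>

lemma transitions_add_sum:
  assumes "finite I" "\<And>i. i \<in> I \<Longrightarrow> c i = 0 \<or> (\<exists>j. c i = 2 ^ j \<or> c i = - (2 ^ j))"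
  shows "transitions (z + sum c I) \<le> transitions z + 2 * card I"
  using assms
proof (induction I arbitrary: z rule: finite_induct)
  case (insert i I)
  have "c i = 0 \<or> (\<exists>j. c i = 2 ^ j \<or> c i = - (2 ^ j))" using insert.prems by blast
  then have "transitions (z + c i) \<le> transitions z + 2"
  proof (elim disjE exE)
    fix j assume "c i = - (2 ^ j)"
    then show ?thesis using transitions_add_power[of "z + c i" j] by simp
  qed (use transitions_add_power[of z] in auto)
  moreover have "transitions (z + c i + sum c I) \<le> transitions (z + c i) + 2 * card I"
    using insert by auto
  ultimately show ?case using insert.hyps by (simp add: add.assoc)
qed simp

lemma transitions_power_mult: "transitions (2 ^ l * z) = transitions z"
  by (induction l) (simp_all add: transitions_double mult.assoc)

text \<open>\<open>2 ^ q * (w + 1) - 1\<close> is \<open>w\<close> followed by \<open>q\<close>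
  ones. As \<open>w\<close> ends in zero, the first of them opens a block, which costs two; the
  others prolong it.\<close>

lemma transitions_ones:
  assumes "even w" "0 < q"
  shows "transitions (2 ^ q * (w + 1) - 1) = transitions w + 2"
  using assms(2)
proof (induction q)
  case (Suc q)
  have eq: "2 ^ Suc q * (w + 1) - 1 = 2 * (2 ^ q * (w + 1) - 1) + 1" by simp
  show ?case
  proof (cases "q = 0")
    case True
    then show ?thesis using assms(1) transitions_double_Suc[of w] by (simp add: algebra_simps)
  next
    case False
    then show ?thesis using Suc.IH unfolding eq transitions_double_Suc by simp
  qed
qed simp

text \<open>The number is zero or a single block of \<open>n - j\<close> ones followed by
  \<open>j\<close> zeros.\<close>

lemma transitions_power_diff:
  assumes "j \<le> n"
  shows "transitions (2 ^ n - 2 ^ j) \<le> 2"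
proof -
  have "2 ^ n - 2 ^ j = (2 ^ j * (2 ^ (n - j) * (0 + 1) - 1) :: int)"
    using assms by (simp add: algebra_simps flip: power_add)
  then show ?thesis
    using transitions_ones[of 0 "n - j"] by (cases "n - j = 0") (simp_all only: transitions_power_mult, simp_all)
qed

lemma transitions_power: "transitions (2 ^ n) = 2"
  using transitions_power_mult[of n 1] transitions_double_Suc[of 0] by simp

section \<open>Existence and uniqueness of the block representation\<close>

definition proper_blocks :: "(nat \<times> nat) list \<Rightarrow> bool" where
  "proper_blocks bs \<longleftrightarrow> (\<forall>(q, l)\<in>set bs. 0 < q \<and> 0 < l)"

text \<open>Once a block follows, all earlier zero runs must be nonempty. The value is then
  \<open>2 ^ l\<close> times an odd number, and that number plus one is \<open>2 ^ q\<close> times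
  an odd number; this drives both existence and uniqueness.\<close>

lemma block_rep_snoc:
  "block_rep k (bs @ [(q, l)]) \<longleftrightarrow>
     proper_blocks bs \<and> 0 < q \<and> k = 2 ^ l * (2 ^ q * (block_value bs + 1) - 1)"
proof -
  have "block_value bs * 2 ^ (q + l) + (2 ^ q - 1) * 2 ^ l = 2 ^ l * (2 ^ q * (block_value bs + 1) - 1)"
    by (simp add: power_add algebra_simps)
  then have "block_value (bs @ [(q, l)]) = 2 ^ l * (2 ^ q * (block_value bs + 1) - 1)"
    by (simp only: block_value_snoc)
  then show ?thesis
    unfolding block_rep_def block_value_def[symmetric] proper_blocks_def by auto
qed

lemma block_rep_Nil: "block_rep k [] \<longleftrightarrow> k = 0"
  using block_value_Nil by (auto simp: block_rep_def block_value_def)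

lemma block_rep_value: "block_rep k bs \<Longrightarrow> k = block_value bs"
  by (simp add: block_rep_def block_value_def)

lemma proper_blocks_rep: "proper_blocks bs \<Longrightarrow> block_rep (block_value bs) bs"
  by (auto simp: block_rep_def block_value_def proper_blocks_def dest!: in_set_butlastD)

lemma even_proper_blocks: "proper_blocks bs \<Longrightarrow> even (block_value bs)"
  by (cases bs rule: rev_cases)
    (auto simp: block_value_Nil block_value_snoc proper_blocks_def)

lemma odd_part_unique:
  fixes u u' :: nat
  assumes "2 ^ l * u = 2 ^ l' * u'" "odd u" "odd u'"
  shows "l = l' \<and> u = u'"
  using assms(1)
proof (induction l arbitrary: l')
  case 0
  then show ?case using assms(2,3) by (cases l') auto
next
  case (Suc l)
  then show ?case using assms(2,3) by (cases l') (auto simp: mult.assoc)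
qed

lemma odd_part_exists:
  fixes k :: nat
  assumes "0 < k"
  shows "\<exists>l u. odd u \<and> k = 2 ^ l * u"
  using assms
proof (induction k rule: less_induct)
  case (less k)
  show ?case
  proof (cases "even k")
    case True
    then obtain m where m: "k = 2 * m" by blast
    then obtain l u where "odd u" "m = 2 ^ l * u" using less.IH[of m] less.prems by auto
    then show ?thesis using m by (intro exI[of _ "Suc l"] exI[of _ u]) simp
  next
    case False
    then show ?thesis by (intro exI[of _ 0] exI[of _ k]) simp
  qed
qed

lemma odd_ones:
  fixes w :: nat
  assumes "0 < q" shows "odd (2 ^ q * (w + 1) - 1)"
  using assms by (cases q) auto

text \<open>The power of two in \<open>k\<close> determines \<open>l\<close>. Adding one to the odd
  part and extracting its power of two determines \<open>q\<close> and the value of the remaining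
  list, because that value is even.\<close>

lemma block_rep_unique: "block_rep k bs \<Longrightarrow> block_rep k bs' \<Longrightarrow> bs = bs'"
proof (induction bs arbitrary: k bs' rule: rev_induct)
  case Nil
  then have k: "k = 0" by (simp add: block_rep_Nil)
  show ?case
  proof (cases bs' rule: rev_cases)
    case (snoc cs x)
    obtain q l where "x = (q, l)" by fastforce
    then have "0 < q" "k = 2 ^ l * (2 ^ q * (block_value cs + 1) - 1)"
      using Nil snoc by (auto simp: block_rep_snoc)
    moreover from this have "odd (2 ^ q * (block_value cs + 1) - 1)" by (intro odd_ones)
    ultimately show ?thesis using k by (metis even_zero mult_eq_0_iff power_not_zero zero_neq_numeral)
  qed simp
next
  case (snoc x bs)
  obtain q l where x: "x = (q, l)" by fastforce
  have 1: "proper_blocks bs" "0 < q" "k = 2 ^ l * (2 ^ q * (block_value bs + 1) - 1)"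
    using snoc.prems(1) unfolding x block_rep_snoc by blast+
  have odd: "odd (2 ^ q * (block_value bs + 1) - 1)" using 1(2) by (rule odd_ones)
  show ?case
  proof (cases bs' rule: rev_cases)
    case Nil
    then have "k = 0" using snoc.prems by (simp add: block_rep_Nil)
    then show ?thesis using 1 odd by (metis even_zero mult_eq_0_iff power_not_zero zero_neq_numeral)
  next
    case (snoc cs y)
    obtain q' l' where y: "y = (q', l')" by fastforce
    have 2: "proper_blocks cs" "0 < q'" "k = 2 ^ l' * (2 ^ q' * (block_value cs + 1) - 1)"
      using \<open>block_rep k bs'\<close> unfolding snoc y block_rep_snoc by blast+
    have odd': "odd (2 ^ q' * (block_value cs + 1) - 1)" using 2(2) by (rule odd_ones)
    have l: "l = l'" and u: "2 ^ q * (block_value bs + 1) - 1 = 2 ^ q' * (block_value cs + 1) - 1"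
      using odd_part_unique[OF _ odd odd', of l l'] 1(3) 2(3) by simp_all
    have "2 ^ q * (block_value bs + 1) \<noteq> 0" "2 ^ q' * (block_value cs + 1) \<noteq> 0" by simp_all
    with u have "2 ^ q * (block_value bs + 1) = 2 ^ q' * (block_value cs + 1)" by linarith
    then have q: "q = q'" and v: "block_value bs = block_value cs"
      using odd_part_unique[of q "block_value bs + 1" q' "block_value cs + 1"]
        even_proper_blocks[OF 1(1)] even_proper_blocks[OF 2(1)] by auto
    have "bs = cs"
      using snoc.IH[of "block_value bs" cs] proper_blocks_rep[OF 1(1)] proper_blocks_rep[OF 2(1)] v
      by simp
    then show ?thesis using x y l q snoc by simp
  qed
qed

lemma block_rep_exists: "\<exists>bs. block_rep k bs"
proof (induction k rule: less_induct)
  case (less k)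
  show ?case
  proof (cases "k = 0")
    case True
    then show ?thesis using block_rep_Nil by blast
  next
    case False
    then obtain l u where u: "odd u" "k = 2 ^ l * u" using odd_part_exists by blast
    obtain q v where v: "odd v" "u + 1 = 2 ^ q * v" using odd_part_exists[of "u + 1"] by auto
    have "0 < v" using v(1) by (rule odd_pos)
    have q: "0 < q" using u(1) v by (cases q) auto
    \<comment> \<open>From \<open>2 * v \<le> u + 1 \<le> k + 1\<close> and \<open>v > 0\<close> the
      remaining value \<open>v - 1\<close> is smaller than \<open>k\<close>.\<close>
    have "2 * v \<le> 2 ^ q * v" using q by (cases q) auto
    moreover have "u \<le> k" using u(2) by simp
    ultimately have "v - 1 < k" using v(2) \<open>0 < v\<close> by linarith
    then obtain bs where bs: "block_rep (v - 1) bs" using less by blast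
    then have val: "v - 1 = block_value bs" by (rule block_rep_value)
    have "proper_blocks bs"
    proof (cases bs rule: rev_cases)
      case Nil
      then show ?thesis by (simp add: proper_blocks_def)
    next
      case (snoc cs x)
      obtain q' l' where x: "x = (q', l')" by fastforce
      have *: "proper_blocks cs" "0 < q'" "v - 1 = 2 ^ l' * (2 ^ q' * (block_value cs + 1) - 1)"
        using bs unfolding snoc x block_rep_snoc by blast+
      \<comment> \<open>An even value cannot end in a one, so the last zero run is nonempty and
        another block may follow.\<close>
      have "even (v - 1)" using v(1) by simp
      moreover have "odd (2 ^ q' * (block_value cs + 1) - 1)" using *(2) by (rule odd_ones)
      ultimately have "0 < l'" using *(3) by (metis gr0I mult_1 power_0)
      then show ?thesis using * snoc x by (auto simp: proper_blocks_def)
    qed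
    moreover have "k = 2 ^ l * (2 ^ q * (block_value bs + 1) - 1)"
    proof -
      have "2 ^ q * (block_value bs + 1) - 1 = u"
        using v(2) \<open>0 < v\<close> by (simp flip: val)
      then show ?thesis using u(2) by simp
    qed
    ultimately have "block_rep k (bs @ [(q, l)])" using q block_rep_snoc by blast
    then show ?thesis by blast
  qed
qed

lemma bl_eq: "block_rep k bs \<Longrightarrow> bl k = length bs"
  unfolding bl_def using block_rep_unique by (metis the_equality)

lemma transitions_block_rep: "block_rep k bs \<Longrightarrow> transitions (int k) = 2 * length bs"
proof (induction bs arbitrary: k rule: rev_induct)
  case Nil
  then show ?case by (simp add: block_rep_Nil)
next
  case (snoc x bs)
  obtain q l where x: "x = (q, l)" by fastforce
  have *: "proper_blocks bs" "0 < q" "k = 2 ^ l * (2 ^ q * (block_value bs + 1) - 1)"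
    using snoc.prems unfolding x block_rep_snoc by blast+
  have "0 < 2 ^ q * (block_value bs + 1)" by simp
  then have ge: "1 \<le> 2 ^ q * (block_value bs + 1)" by linarith
  have "int k = 2 ^ l * (2 ^ q * (int (block_value bs) + 1) - 1)"
    unfolding *(3) by (simp only: of_nat_mult of_nat_power of_nat_diff[OF ge]) simp
  then show ?case
    using snoc.IH[OF proper_blocks_rep[OF *(1)]] even_proper_blocks[OF *(1)] *(2)
      transitions_ones[of "int (block_value bs)" q]
    by (simp add: transitions_power_mult)
qed

lemma transitions_eq_bl: "transitions (int k) = 2 * bl k"
  using block_rep_exists[of k] transitions_block_rep bl_eq by metis

section \<open>The lower bound\<close>

definition models :: "nat set \<Rightarrow> literal set \<Rightarrow> (nat \<Rightarrow> bool) set" where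
  "models V C = {a \<in> assignments V. \<forall>l\<in>C. holds a l}"

lemma finite_assignments: "finite V \<Longrightarrow> finite (assignments V)"
  unfolding assignments_def by (simp add: finite_PiE)

lemma card_assignments: "finite V \<Longrightarrow> card (assignments V) = 2 ^ card V"
  unfolding assignments_def by (simp add: card_PiE)

lemma models_subset: "models V C \<subseteq> assignments V"
  by (simp add: models_def)

text \<open>A contradictory term has no model. Otherwise any model \<open>b\<close> supplies the
  prescribed values, and the models form a subcube. The bound on \<open>j\<close> is what
  \<open>transitions_power_diff\<close> asks for.\<close>

lemma card_models:
  assumes "finite V" "var ` C \<subseteq> V"
  shows "card (models V C) = 0 \<or> (\<exists>j \<le> card V. card (models V C) = 2 ^ j)"
proof (cases "models V C = {}")
  case False
  then obtain b where b: "b \<in> models V C" by blast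
  have "holds a l \<longleftrightarrow> a (var l) = b (var l)" if "l \<in> C" for a l
    using b that by (cases l) (force simp: models_def)+
  then have "models V C = subcube V (var ` C) b"
    by (simp add: models_def subcube_def assignments_def)
  then have "card (models V C) = 2 ^ card (V - var ` C)"
    using card_subcube[OF assms] by simp
  moreover have "card (V - var ` C) \<le> card V" using assms(1) by (intro card_mono) auto
  ultimately show ?thesis by blast
qed simp

lemma transitions_card_Union_models:
  assumes V: "finite V" and F: "finite F" "F \<noteq> {}" and var: "\<And>C. C \<in> F \<Longrightarrow> var ` C \<subseteq> V"
  defines "U \<equiv> \<Union>(models V ` F)"
  shows "transitions (int (card U)) \<le> 2 * (2 ^ card F - 1)"
    and "transitions (2 ^ card V - int (card U)) \<le> 2 * (2 ^ card F - 1)"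
proof -
  define A where "A = models V ` F"
  define P where "P = Pow A - {{}}"
  define c where "c = (\<lambda>I :: (nat \<Rightarrow> bool) set set. (- 1) ^ (card I + 1) * int (card (\<Inter>I)))"
  have A: "finite A" "A \<noteq> {}" using F by (auto simp: A_def)
  have finA: "finite K" if "K \<in> A" for K
    using that finite_assignments[OF V] models_subset by (auto simp: A_def intro: finite_subset)
  have finP: "finite P" using A(1) by (simp add: P_def)
  have cardP: "card P = 2 ^ card A - 1"
    using A(1) by (simp add: P_def card_Pow card_Diff_singleton)
  \<comment> \<open>Different terms can have the same model set, so \<open>A\<close> may be smaller
    than \<open>F\<close>.\<close>
  have le: "(2 :: nat) ^ card A \<le> 2 ^ card F"
    using card_image_le[OF F(1)] by (simp add: A_def)
  have card_Inter: "card (\<Inter>I) = 0 \<or> (\<exists>j \<le> card V. card (\<Inter>I) = 2 ^ j)" if I: "I \<in> P" for I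
  proof -
    obtain G where G: "G \<subseteq> F" "I = models V ` G" "G \<noteq> {}"
      using I by (auto simp: P_def A_def subset_image_iff)
    \<comment> \<open>A conjunction of terms is again a term, so every summand of
      inclusion-exclusion is zero or a signed power of two.\<close>
    have "\<Inter>I = models V (\<Union>G)" using G(2,3) by (auto simp: models_def)
    moreover have "var ` \<Union>G \<subseteq> V" using G(1) var by blast
    ultimately show ?thesis using card_models[OF V] by simp
  qed
  have c: "c I = 0 \<or> (\<exists>j. c I = 2 ^ j \<or> c I = - (2 ^ j))" if "I \<in> P" for I
  proof -
    have "c I = int (card (\<Inter>I)) \<or> c I = - int (card (\<Inter>I))"
      by (cases "even (card I)") (simp_all add: c_def)
    then show ?thesis using card_Inter[OF that] by auto
  qed
  have U: "int (card U) = sum c P"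
  proof -
    have "{I. I \<subseteq> A \<and> I \<noteq> {}} = P" by (auto simp: P_def)
    then show ?thesis using int_card_UNION[OF A(1) finA] by (simp add: U_def A_def c_def)
  qed
  have "transitions (int (card U)) \<le> 2 * card P"
    using transitions_add_sum[OF finP, of c 0] c U by simp
  then show "transitions (int (card U)) \<le> 2 * (2 ^ card F - 1)"
    using cardP le by linarith
  \<comment> \<open>One singleton summand is merged with \<open>2 ^ card V\<close>. Their difference
    has at most two transitions, so the total does not exceed the DNF bound.\<close>
  obtain X where X: "X \<in> A" using A(2) by blast
  then have XP: "{X} \<in> P" by (simp add: P_def)
  have "transitions (2 ^ card V - c {X}) \<le> 2"
    using card_Inter[OF XP] transitions_power_diff transitions_power by (auto simp: c_def)
  moreover have "transitions (2 ^ card V - c {X} + (\<Sum>I\<in>P - {{X}}. - c I)) \<le>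
      transitions (2 ^ card V - c {X}) + 2 * card (P - {{X}})"
  proof (rule transitions_add_sum)
    fix I assume "I \<in> P - {{X}}"
    then show "- c I = 0 \<or> (\<exists>j. - c I = 2 ^ j \<or> - c I = - (2 ^ j))"
      using c[of I] by (auto simp: equation_minus_iff minus_equation_iff)
  qed (use finP in simp)
  moreover have eq: "2 ^ card V - c {X} + (\<Sum>I\<in>P - {{X}}. - c I) = 2 ^ card V - int (card U)"
    using sum.remove[OF finP XP, of c] by (simp add: U sum_negf)
  moreover have "card (P - {{X}}) = 2 ^ card A - 2" using XP finP cardP by simp
  \<comment> \<open>Rules out truncation in
    \<open>2 + 2 * (2 ^ card A - 2) = 2 * (2 ^ card A - 1)\<close>.\<close>
  moreover have "2 \<le> (2 :: nat) ^ card A"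
    using power_increasing[of 1 "card A" "2 :: nat"] A by (simp add: card_gt_0_iff Suc_le_eq)
  ultimately show "transitions (2 ^ card V - int (card U)) \<le> 2 * (2 ^ card F - 1)"
    using le unfolding eq by linarith
qed

primrec negate :: "literal \<Rightarrow> literal" where
  "negate (Pos x) = Neg x"
| "negate (Neg x) = Pos x"

lemma holds_negate [simp]: "holds a (negate l) \<longleftrightarrow> \<not> holds a l"
  by (cases l) auto

lemma var_negate [simp]: "var (negate l) = var l"
  by (cases l) auto

text \<open>By De Morgan the assignments falsifying a CNF are the models of the DNF of its negated
  clauses, so the count is \<open>2 ^ card V\<close> minus a union count. Halving the transition
  bound gives the claim.\<close>

lemma bl_le_formula:
  assumes V: "finite V" and F: "formula_over V F"
    and k: "card {a \<in> assignments V. sat_dnf a F} = k \<or> card {a \<in> assignments V. sat_cnf a F} = k"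
  shows "bl k + 1 \<le> 2 ^ card F"
proof -
  have F': "finite F" "F \<noteq> {}" "\<And>C. C \<in> F \<Longrightarrow> var ` C \<subseteq> V"
    using F by (auto simp: formula_over_def)
  have "transitions (int k) \<le> 2 * (2 ^ card F - 1)"
    using k
  proof
    assume "card {a \<in> assignments V. sat_dnf a F} = k"
    moreover have "{a \<in> assignments V. sat_dnf a F} = \<Union>(models V ` F)"
      by (auto simp: sat_dnf_def models_def)
    ultimately show ?thesis
      using transitions_card_Union_models(1)[OF V F'] by simp
  next
    assume k: "card {a \<in> assignments V. sat_cnf a F} = k"
    let ?F = "(`) negate ` F"
    let ?U = "\<Union>(models V ` ?F)"
    have "card {a \<in> assignments V. sat_cnf a F} + card ?U = 2 ^ card V"
    proof -
      have "{a \<in> assignments V. sat_cnf a F} \<union> ?U = assignments V"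
        "{a \<in> assignments V. sat_cnf a F} \<inter> ?U = {}"
        by (auto simp: sat_cnf_def models_def)
      moreover have "finite {a \<in> assignments V. sat_cnf a F}" "finite ?U"
        by (rule finite_subset[OF _ finite_assignments[OF V]]; auto simp: models_def)+
      ultimately show ?thesis
        using card_Un_disjoint[of "{a \<in> assignments V. sat_cnf a F}" ?U]
          card_assignments[OF V] by simp
    qed
    then have "int (k + card ?U) = int (2 ^ card V)" using k by simp
    then have eq: "int k = 2 ^ card V - int (card ?U)" by simp
    have "transitions (2 ^ card V - int (card ?U)) \<le> 2 * (2 ^ card ?F - 1)"
    proof (rule transitions_card_Union_models(2)[OF V])
      fix C assume "C \<in> ?F"
      then show "var ` C \<subseteq> V" using F'(3) by (fastforce simp: image_image)
    qed (use F' in auto)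
    moreover have "(2 :: nat) ^ card ?F \<le> 2 ^ card F" using card_image_le[OF F'(1)] by simp
    ultimately show ?thesis unfolding eq by linarith
  qed
  moreover have "1 \<le> (2 :: nat) ^ card F" by simp
  ultimately show ?thesis unfolding transitions_eq_bl by linarith
qed

section \<open>Passage from realizability to \<beta>\<close>

lemma beta_le:
  assumes "realizable k m" "0 < k"
  shows "\<beta> k \<le> m"
proof -
  obtain V F where VF: "finite V" "formula_over V F" "card F \<le> m"
    "card {a \<in> assignments V. sat_dnf a F} = k"
    using realizable_dnf[OF assms] by blast
  have "\<beta> k \<le> card F" unfolding \<beta>_def by (rule Least_le) (use VF in blast)
  then show ?thesis using VF(3) by simp
qed

text \<open>Realizability ensures that some formula exists, so that \<open>LEAST\<close> is
  attained; \<open>bl_le_formula\<close> then applies to a formula of minimum size.\<close>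

lemma bl_le_beta:
  assumes "realizable k m" "0 < k"
  shows "bl k + 1 \<le> 2 ^ \<beta> k"
proof -
  obtain V F where "finite V" "formula_over V F" "card {a \<in> assignments V. sat_dnf a F} = k"
    using realizable_dnf[OF assms] by blast
  then have "\<exists>m V F. finite V \<and> formula_over V F \<and> card F = m \<and>
      (card {a \<in> assignments V. sat_dnf a F} = k \<or> card {a \<in> assignments V. sat_cnf a F} = k)"
    by blast
  from LeastI_ex[OF this] have "\<exists>V F. finite V \<and> formula_over V F \<and> card F = \<beta> k \<and>
      (card {a \<in> assignments V. sat_dnf a F} = k \<or> card {a \<in> assignments V. sat_cnf a F} = k)"
    unfolding \<beta>_def .
  then show ?thesis
  proof (elim exE conjE)
    fix V F
    assume "finite V" "formula_over V F" "card F = \<beta> k"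
      "card {a \<in> assignments V. sat_dnf a F} = k \<or> card {a \<in> assignments V. sat_cnf a F} = k"
    then show ?thesis using bl_le_formula[of V F k] by simp
  qed
qed

lemma realizable_bl:
  assumes "0 < k"
  shows "realizable k (bl k + 1)"
proof -
  obtain bs where bs: "block_rep k bs" using block_rep_exists by blast
  have "bs \<noteq> []" using bs assms by (auto simp: block_rep_Nil)
  \<comment> \<open>One capacity serves the whole chain, so it is taken as the longest run of
    ones.\<close>
  moreover define B where "B = Max (fst ` set bs)"
  have "\<forall>(q, l)\<in>set bs. 0 < q \<and> q \<le> B"
    using bs by (auto simp: block_rep_def B_def intro!: Max_ge image_eqI)
  ultimately have "cube_chain (block_value bs) (length bs + 1) B" by (rule cube_chain_block_value)
  then show ?thesis
    using realizable_cube_chain bl_eq[OF bs] block_rep_value[OF bs] by simp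
qed

section \<open>The square root bound\<close>

context
  fixes s :: nat and P :: "nat \<Rightarrow> nat \<Rightarrow> bool"
begin

text \<open>
  Variables are pairs of a tag and an index. Rows prescribe tag 0 below \<open>i * s\<close> and all of tag 2, columns
  all of tag 0 and tag 2 below \<open>j\<close>; so their union leaves \<open>i * s + j\<close> variables of the padding tags 1 and 3
  open. Tags 4 and 5 make rows respectively columns disjoint, tag 6 lets row \<open>i\<close> conflict with column \<open>j\<close>.
\<close>

definition grid_vars :: "(nat \<times> nat) set" where
  "grid_vars = {0, 1} \<times> {..<s * s} \<union> {2, 3, 4, 5, 6} \<times> {..<s}"

definition row_vars :: "nat \<Rightarrow> (nat \<times> nat) set" where
  "row_vars i = {0} \<times> {..<i * s} \<union> {1} \<times> {i * s..<s * s} \<union> {2, 4, 6} \<times> {..<s}"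

definition row_val :: "nat \<Rightarrow> nat \<times> nat \<Rightarrow> bool" where
  "row_val i = (\<lambda>(t, r). if t = 4 then r = i else if t = 6 then P i r else True)"

definition col_vars :: "nat \<Rightarrow> (nat \<times> nat) set" where
  "col_vars j = {0} \<times> {..<s * s} \<union> {2} \<times> {..<j} \<union> {3} \<times> {j..<s} \<union> {5} \<times> {..<s} \<union> {(6, j)}"

definition col_val :: "nat \<Rightarrow> nat \<times> nat \<Rightarrow> bool" where
  "col_val j = (\<lambda>(t, r). if t = 5 then r = j else True)"

abbreviation row_cube where "row_cube i \<equiv> subcube grid_vars (row_vars i) (row_val i)"
abbreviation col_cube where "col_cube j \<equiv> subcube grid_vars (col_vars j) (col_val j)"

lemma finite_grid_vars: "finite grid_vars"
  by (simp add: grid_vars_def)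

lemma row_mult_le: "i < s \<Longrightarrow> i * s \<le> s * s"
  by (simp add: mult_le_mono1)

lemma row_mult_less: "r < i * s \<Longrightarrow> i < s \<Longrightarrow> r < s * s"
  by (erule less_le_trans) (rule row_mult_le)

lemma row_vars_subset: "i < s \<Longrightarrow> row_vars i \<subseteq> grid_vars"
  by (auto simp: row_vars_def grid_vars_def dest: row_mult_less)

lemma col_vars_subset: "j < s \<Longrightarrow> col_vars j \<subseteq> grid_vars"
  by (auto simp: col_vars_def grid_vars_def)

lemma card_tagged:
  assumes "finite A" "finite X" "\<And>r. (t, r) \<notin> X"
  shows "card ({t} \<times> A \<union> X) = card A + card X"
proof -
  have "({t} \<times> A) \<inter> X = {}" using assms(3) by auto
  then show ?thesis
    using assms by (subst card_Un_disjoint) (auto simp: card_cartesian_product)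
qed

text \<open>Tag 1 compensates for tag 0: together they leave \<open>s * s\<close> variables open
  whatever \<open>i\<close> is. Tags 3 and 5 add \<open>2 * s\<close>.\<close>

lemma card_row_cube:
  assumes "i < s" shows "card (row_cube i) = 2 ^ (s * s + 2 * s)"
proof -
  have "grid_vars - row_vars i =
      {0} \<times> {i * s..<s * s} \<union> ({1} \<times> {..<i * s} \<union> ({3} \<times> {..<s} \<union> ({5} \<times> {..<s} \<union> {})))"
    using assms by (auto simp: grid_vars_def row_vars_def dest: row_mult_less)
  also have "card \<dots> = (s * s - i * s) + (i * s + (s + s))"
    by (subst card_tagged; simp)+
  also have "\<dots> = s * s + 2 * s" using row_mult_le[OF assms] by linarith
  finally show ?thesis
    using card_subcube[OF finite_grid_vars row_vars_subset[OF assms]] by simp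
qed

text \<open>Tags 2 and 3 together leave \<open>s\<close> variables open for every \<open>j\<close>.
  The \<open>- 1\<close> is the variable \<open>(6, j)\<close>, the only one of tag 6 that column
  \<open>j\<close> fixes.\<close>

lemma card_col_cube:
  assumes "j < s" shows "card (col_cube j) = 2 ^ (s * s + 3 * s - 1)"
proof -
  have "grid_vars - col_vars j = {1} \<times> {..<s * s} \<union> ({2} \<times> {j..<s} \<union> ({3} \<times> {..<j} \<union>
      ({4} \<times> {..<s} \<union> ({6} \<times> ({..<s} - {j}) \<union> {}))))"
    using assms by (auto simp: grid_vars_def col_vars_def)
  also have "card \<dots> = s * s + 3 * s - 1"
    using assms by (subst card_tagged; simp)+
  finally show ?thesis
    using card_subcube[OF finite_grid_vars col_vars_subset[OF assms]] by simp
qed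

text \<open>Row \<open>i\<close> and column \<open>j\<close> can conflict only at
  \<open>(6, j)\<close>, where the row prescribes \<open>P i j\<close> and the column true. Without
  conflict \<open>i * s\<close> variables of tag 1 and \<open>j\<close> of tag 3 stay open.\<close>

lemma card_row_Int_col:
  assumes "i < s" "j < s"
  shows "card (row_cube i \<inter> col_cube j) = (if P i j then 2 ^ (i * s + j) else 0)"
proof (cases "P i j")
  case True
  have "row_cube i \<inter> col_cube j = subcube grid_vars (row_vars i \<union> col_vars j)
      (\<lambda>v. if v \<in> row_vars i then row_val i v else col_val j v)"
    by (rule subcube_Int) (use True in \<open>auto simp: row_vars_def col_vars_def row_val_def col_val_def\<close>)
  moreover have "grid_vars - (row_vars i \<union> col_vars j) = {1} \<times> {..<i * s} \<union> ({3} \<times> {..<j} \<union> {})"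
  proof (rule set_eqI)
    fix v :: "nat \<times> nat"
    obtain t r where v: "v = (t, r)" by fastforce
    have r: "r < s * s" if "r < i * s" using row_mult_less that assms(1) by blast
    have "t = 0 \<or> t = 1 \<or> t = 2 \<or> t = 3 \<or> t = 4 \<or> t = 5 \<or> t = 6 \<or> 6 < t" by arith
    then show "v \<in> grid_vars - (row_vars i \<union> col_vars j) \<longleftrightarrow>
        v \<in> {1} \<times> {..<i * s} \<union> ({3} \<times> {..<j} \<union> {})"
      unfolding v grid_vars_def row_vars_def col_vars_def
    proof (elim disjE)
      assume "t = 1"
      then show "(t, r) \<in> {0, 1} \<times> {..<s * s} \<union> {2, 3, 4, 5, 6} \<times> {..<s} -
         ({0} \<times> {..<i * s} \<union> {1} \<times> {i * s..<s * s} \<union> {2, 4, 6} \<times> {..<s} \<union>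
          ({0} \<times> {..<s * s} \<union> {2} \<times> {..<j} \<union> {3} \<times> {j..<s} \<union> {5} \<times> {..<s} \<union> {(6, j)})) \<longleftrightarrow>
         (t, r) \<in> {1} \<times> {..<i * s} \<union> ({3} \<times> {..<j} \<union> {})"
        using r by (simp del: mult_less_cancel2) (metis not_less)
    qed (use assms in auto)
  qed
  moreover have "card ({1 :: nat} \<times> {..<i * s} \<union> ({3} \<times> {..<j} \<union> {})) = i * s + j"
    by (subst card_tagged; simp)+
  ultimately show ?thesis
    using card_subcube[OF finite_grid_vars] row_vars_subset[OF assms(1)] col_vars_subset[OF assms(2)] True
    by simp
next
  case False
  have "row_cube i \<inter> col_cube j = {}"
    by (rule subcube_disjoint[of "(6, j)"])
      (use False assms in \<open>auto simp: row_vars_def col_vars_def row_val_def col_val_def\<close>)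
  then show ?thesis using False by simp
qed

lemma row_cubes_disjoint: "i < s \<Longrightarrow> i \<noteq> i' \<Longrightarrow> row_cube i \<inter> row_cube i' = {}"
  by (rule subcube_disjoint[of "(4, i)"]) (auto simp: row_vars_def row_val_def)

lemma col_cubes_disjoint: "j < s \<Longrightarrow> j \<noteq> j' \<Longrightarrow> col_cube j \<inter> col_cube j' = {}"
  by (rule subcube_disjoint[of "(5, j)"]) (auto simp: col_vars_def col_val_def)

text \<open>Rows are pairwise disjoint and so are columns, so inclusion-exclusion stops at
  row-column pairs. The additive form avoids natural subtraction.\<close>

lemma realizable_grid:
  "\<exists>K. realizable K (2 * s) \<and>
     K + (\<Sum>i<s. \<Sum>j<s. if P i j then 2 ^ (i * s + j) else 0) =
     s * 2 ^ (s * s + 2 * s) + s * 2 ^ (s * s + 3 * s - 1)"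
proof -
  let ?R = "(\<lambda>i. (row_vars i, row_val i)) ` {..<s}" and ?C = "(\<lambda>j. (col_vars j, col_val j)) ` {..<s}"
  have R: "cubes grid_vars ?R = (\<Union>i<s. row_cube i)" and C: "cubes grid_vars ?C = (\<Union>j<s. col_cube j)"
    by (simp_all add: cubes_def)
  have "card (\<Union>i<s. row_cube i) = (\<Sum>i<s. card (row_cube i))"
    by (rule card_UN_disjoint) (use finite_grid_vars row_cubes_disjoint in auto)
  then have cardR: "card (cubes grid_vars ?R) = s * 2 ^ (s * s + 2 * s)"
    by (simp add: R card_row_cube)
  have "card (\<Union>j<s. col_cube j) = (\<Sum>j<s. card (col_cube j))"
    by (rule card_UN_disjoint) (use finite_grid_vars col_cubes_disjoint in auto)
  then have cardC: "card (cubes grid_vars ?C) = s * 2 ^ (s * s + 3 * s - 1)"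
    by (simp add: C card_col_cube)
  have inner: "card (\<Union>j<s. row_cube i \<inter> col_cube j) = (\<Sum>j<s. card (row_cube i \<inter> col_cube j))" for i
  proof (rule card_UN_disjoint)
    show "\<forall>j\<in>{..<s}. \<forall>j'\<in>{..<s}. j \<noteq> j' \<longrightarrow>
        (row_cube i \<inter> col_cube j) \<inter> (row_cube i \<inter> col_cube j') = {}"
    proof (intro ballI impI)
      fix j j' assume "j \<in> {..<s}" "j \<noteq> j'"
      then have "col_cube j \<inter> col_cube j' = {}" by (intro col_cubes_disjoint) simp_all
      then show "(row_cube i \<inter> col_cube j) \<inter> (row_cube i \<inter> col_cube j') = {}" by blast
    qed
  qed (simp_all add: finite_grid_vars)
  have Int: "cubes grid_vars ?R \<inter> cubes grid_vars ?C = (\<Union>i<s. \<Union>j<s. row_cube i \<inter> col_cube j)"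
    unfolding R C by blast
  have "card (\<Union>i<s. \<Union>j<s. row_cube i \<inter> col_cube j) = (\<Sum>i<s. card (\<Union>j<s. row_cube i \<inter> col_cube j))"
  proof (rule card_UN_disjoint)
    show "\<forall>i\<in>{..<s}. \<forall>i'\<in>{..<s}. i \<noteq> i' \<longrightarrow>
        (\<Union>j<s. row_cube i \<inter> col_cube j) \<inter> (\<Union>j<s. row_cube i' \<inter> col_cube j) = {}"
    proof (intro ballI impI)
      fix i i' assume "i \<in> {..<s}" "i \<noteq> i'"
      then have "row_cube i \<inter> row_cube i' = {}" by (intro row_cubes_disjoint) simp_all
      then show "(\<Union>j<s. row_cube i \<inter> col_cube j) \<inter> (\<Union>j<s. row_cube i' \<inter> col_cube j) = {}"
        by blast
    qed
  qed (simp_all add: finite_grid_vars)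
  also have "\<dots> = (\<Sum>i<s. \<Sum>j<s. card (row_cube i \<inter> col_cube j))"
    by (simp only: inner)
  also have "\<dots> = (\<Sum>i<s. \<Sum>j<s. if P i j then 2 ^ (i * s + j) else 0)"
    by (intro sum.cong refl) (simp add: card_row_Int_col)
  finally have "card (\<Union>i<s. \<Union>j<s. row_cube i \<inter> col_cube j) =
      (\<Sum>i<s. \<Sum>j<s. if P i j then 2 ^ (i * s + j) else 0)" .
  then have "card (cubes grid_vars (?R \<union> ?C)) +
      (\<Sum>i<s. \<Sum>j<s. if P i j then 2 ^ (i * s + j) else 0) =
      s * 2 ^ (s * s + 2 * s) + s * 2 ^ (s * s + 3 * s - 1)"
    using card_Un_Int[of "cubes grid_vars ?R" "cubes grid_vars ?C"] finite_grid_vars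
    by (simp add: cubes_Un cardR cardC Int)
  moreover have "realizable (card (cubes grid_vars (?R \<union> ?C))) (2 * s)"
  proof (rule realizableI)
    show "inj prod_encode" by (rule inj_prod_encode)
    have "card ?R \<le> card {..<s}" "card ?C \<le> card {..<s}"
      by (rule card_image_le; simp)+
    then show "card (?R \<union> ?C) \<le> 2 * s" using card_Un_le[of ?R ?C] by simp
    show "W \<subseteq> grid_vars" if "(W, f) \<in> ?R \<union> ?C" for W f
      using that row_vars_subset col_vars_subset by blast
  qed (simp_all add: finite_grid_vars)
  ultimately show ?thesis by blast
qed

end

lemma sum_bits:
  assumes "D < 2 ^ (s * s)"
  shows "(\<Sum>i<s. \<Sum>j<s. if bit D (i * s + j) then 2 ^ (i * s + j) else 0) = (D :: nat)"
proof -
  let ?f = "\<lambda>e. if bit D e then 2 ^ e else 0 :: nat"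
  \<comment> \<open>The numbers \<open>i * s + j\<close> run through all positions below
    \<open>s * s\<close> exactly once, so the double sum is the binary expansion of
    \<open>D\<close>.\<close>
  have "(\<Sum>i<s. \<Sum>j<s. ?f (i * s + j)) = (\<Sum>i<s. sum ?f {i * s..<i * s + s})"
  proof (rule sum.cong[OF refl])
    fix i
    show "(\<Sum>j<s. ?f (i * s + j)) = sum ?f {i * s..<i * s + s}"
      using sum.shift_bounds_nat_ivl[of ?f 0 "i * s" s]
      by (simp only: add_0 add_0_right add.commute[of _ "i * s"] lessThan_atLeast0)
  qed
  also have "\<dots> = sum ?f {..<s * s}" by (rule sum.nat_group)
  also have "\<dots> = horner_sum of_bool 2 (map (bit D) [0..<s * s])"
    by (subst horner_sum_eq_sum, rule sum.cong) (auto simp: lessThan_atLeast0)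
  also have "\<dots> = D"
    using assms by (simp add: horner_sum_bit_eq_take_bit take_bit_nat_eq_self)
  finally show ?thesis .
qed

text \<open>Round \<open>k - S\<close> up to a multiple \<open>E * 2 ^ c\<close> and let
  \<open>D\<close> be the excess. The grid yields \<open>K = S - D\<close> with \<open>2 * s\<close>
  cubes, and \<open>E\<close> has at most \<open>6 * s + 5\<close> digits, each costing at most one
  cube.\<close>

lemma realizable_sqrt:
  assumes "2 ^ (s * s + 4 * s) \<le> k" "k < 2 ^ (s * s + 6 * s + 5)"
  shows "realizable k (8 * s + 5)"
proof -
  define c where "c = s * s"
  define S :: nat where "S = s * 2 ^ (s * s + 2 * s) + s * 2 ^ (s * s + 3 * s - 1)"
  define E where "E = (k - S + 2 ^ c - 1) div 2 ^ c"
  define D where "D = E * 2 ^ c - (k - S)"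
  \<comment> \<open>Each half of \<open>S\<close> is at most \<open>2 ^ (s * s + 4 * s - 1)\<close>
    because \<open>s \<le> 2 ^ s\<close>. The lower bound on \<open>S\<close> absorbs the
    \<open>2 ^ c - 1\<close> of the rounding; for \<open>s = 0\<close> that term vanishes.\<close>
  have Sk: "S \<le> k \<and> (s = 0 \<or> 2 ^ c \<le> S)"
  proof (cases s)
    case 0
    then show ?thesis by (simp add: S_def)
  next
    case (Suc r)
    have "s * 2 ^ (s * s + 2 * s) \<le> 2 ^ s * 2 ^ (s * s + 2 * s)"
      by (intro mult_right_mono) (auto simp: less_imp_le)
    also have "\<dots> \<le> 2 ^ (s * s + 4 * s - 1)"
      unfolding power_add[symmetric] by (rule power_increasing) (auto simp: Suc)
    finally have 1: "s * 2 ^ (s * s + 2 * s) \<le> 2 ^ (s * s + 4 * s - 1)" .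
    have "s * 2 ^ (s * s + 3 * s - 1) \<le> 2 ^ s * 2 ^ (s * s + 3 * s - 1)"
      by (intro mult_right_mono) (auto simp: less_imp_le)
    also have "\<dots> = 2 ^ (s * s + 4 * s - 1)"
      unfolding power_add[symmetric] by (simp add: Suc)
    finally have 2: "s * 2 ^ (s * s + 3 * s - 1) \<le> 2 ^ (s * s + 4 * s - 1)" .
    have "2 * 2 ^ (s * s + 4 * s - 1) = (2 :: nat) ^ (s * s + 4 * s)"
      by (subst power_Suc[symmetric]) (simp add: Suc)
    with 1 2 have "S \<le> 2 ^ (s * s + 4 * s)" unfolding S_def by linarith
    moreover have "2 ^ c \<le> S"
    proof -
      have "(2 :: nat) ^ c \<le> 2 ^ (s * s + 2 * s)"
        unfolding c_def by (rule power_increasing) auto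
      also have "\<dots> \<le> s * 2 ^ (s * s + 2 * s)" by (simp add: Suc)
      also have "\<dots> \<le> S" unfolding S_def by (rule le_add1)
      finally show ?thesis .
    qed
    ultimately show ?thesis using assms(1) by linarith
  qed
  have div_mod: "E * 2 ^ c + (k - S + 2 ^ c - 1) mod 2 ^ c = k - S + 2 ^ c - 1"
    unfolding E_def by (rule div_mult_mod_eq)
  have mod: "(k - S + 2 ^ c - 1) mod 2 ^ c < (2 :: nat) ^ c" by simp
  have pos: "(0 :: nat) < 2 ^ c" by simp
  have le: "k - S \<le> E * 2 ^ c" using div_mod mod by linarith
  have D: "D < 2 ^ c" unfolding D_def using div_mod pos by linarith
  have "E < 2 ^ (6 * s + 5)"
  proof -
    have "k - S + 2 ^ c - 1 \<le> k" using Sk by (auto simp: c_def)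
    also have "\<dots> < 2 ^ (6 * s + 5) * 2 ^ c"
      using assms(2) by (simp add: c_def add_ac flip: power_add)
    finally show ?thesis unfolding E_def by (simp add: less_mult_imp_div_less)
  qed
  moreover obtain K where K: "realizable K (2 * s)"
    "K + (\<Sum>i<s. \<Sum>j<s. if bit D (i * s + j) then 2 ^ (i * s + j) else 0) = S"
    using realizable_grid[of s "\<lambda>i j. bit D (i * s + j)"] unfolding S_def by blast
  ultimately have "realizable (K + E * 2 ^ c) (2 * s + (6 * s + 5))" by (intro realizable_add)
  moreover have "K + D = S" using K(2) sum_bits[of D s] D by (simp add: c_def)
  then have "K + E * 2 ^ c = k" using le Sk D unfolding D_def by linarith
  ultimately show ?thesis by (simp add: add_ac)
qed

text \<open>Take the largest \<open>s\<close> satisfying the lower bound. Its failure at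
  \<open>s + 1\<close> is the upper bound, as the exponent there is
  \<open>s * s + 6 * s + 5\<close>.\<close>

lemma sqrt_scale_exists:
  fixes k :: nat
  assumes "0 < k"
  shows "\<exists>s. 2 ^ (s * s + 4 * s) \<le> k \<and> k < 2 ^ (s * s + 6 * s + 5)"
proof -
  define A where "A = {s. 2 ^ (s * s + 4 * s) \<le> k}"
  have "s \<le> k" if "s \<in> A" for s
  proof -
    have "s < 2 ^ s" by simp
    also have "\<dots> \<le> 2 ^ (s * s + 4 * s)" by (rule power_increasing) auto
    finally show ?thesis using that by (simp add: A_def)
  qed
  then have fin: "finite A" by (meson finite_nat_set_iff_bounded_le)
  have "0 \<in> A" using assms by (simp add: A_def)
  define m where "m = Max A"
  have "m \<in> A" using fin \<open>0 \<in> A\<close> Max_in unfolding m_def by blast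
  then have 1: "2 ^ (m * m + 4 * m) \<le> k" by (simp add: A_def)
  have "Suc m \<notin> A" using Max_ge[OF fin, of "Suc m"] unfolding m_def by auto
  then have 2: "k < 2 ^ (Suc m * Suc m + 4 * Suc m)" by (simp only: A_def mem_Collect_eq not_le)
  have "Suc m * Suc m + 4 * Suc m = m * m + 6 * m + 5" by simp
  with 1 2 show ?thesis by metis
qed

lemma sqrt_log_bound:
  fixes k s :: nat
  assumes "k \<ge> 3" "2 ^ (s * s + 4 * s) \<le> k"
  shows "real (8 * s + 5) \<le> 20 * sqrt (log 2 (real k)) * log 2 (log 2 (real k))"
proof -
  define L where "L = log 2 (real k)"
  have "real (s * s + 4 * s) = log 2 (real (2 ^ (s * s + 4 * s)))" by (simp add: log_nat_power)
  also have "\<dots> \<le> L" unfolding L_def using assms by (subst log_le_cancel_iff) (auto simp del: of_nat_power)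
  finally have sL: "real s * real s + 4 * real s \<le> L" by simp
  have "real s \<le> sqrt L"
    by (rule real_le_rsqrt) (use sL in \<open>simp add: power2_eq_square\<close>)
  \<comment> \<open>These come from \<open>2 ^ 3 \<le> 3 ^ 2\<close> and
    \<open>2 \<le> (3 / 2) ^ 2\<close>. They settle \<open>s = 0\<close>, where the right-hand side
    is at least 10 and only 5 is needed.\<close>
  have half: "3 / 2 \<le> log 2 3" "1 / 2 \<le> log 2 (3 / 2 :: real)"
  proof -
    have "log 2 (2 ^ 3) \<le> log 2 (3 ^ 2 :: real)" by (subst log_le_cancel_iff) auto
    then show "3 / 2 \<le> log 2 3" by (simp only: log_nat_power) simp
    have "log 2 (2 ^ 1) \<le> log 2 ((3 / 2) ^ 2 :: real)" by (subst log_le_cancel_iff) (auto simp: power2_eq_square)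
    then show "1 / 2 \<le> log 2 (3 / 2 :: real)" by (simp only: log_nat_power) simp
  qed
  have "log 2 3 \<le> L" unfolding L_def using assms by (subst log_le_cancel_iff) auto
  then have L: "3 / 2 \<le> L" using half(1) by linarith
  have "5 + 8 * real s \<le> 20 * sqrt L * log 2 L"
  proof (cases "s = 0")
    case True
    have "log 2 (3 / 2) \<le> log 2 L" using L by (subst log_le_cancel_iff) auto
    then have "1 / 2 \<le> log 2 L" using half(2) by linarith
    moreover have "1 \<le> sqrt L" using L by simp
    ultimately have "1 * (1 / 2) \<le> sqrt L * log 2 L" by (intro mult_mono) auto
    then show ?thesis using True by simp
  next
    case False
    \<comment> \<open>For \<open>s \<ge> 1\<close> the iterated logarithm is at least 2, so the
      right-hand side is at least \<open>40 * s\<close>, which exceeds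
      \<open>8 * s + 5\<close>.\<close>
    then have "1 \<le> real s" by simp
    moreover from this have "4 \<le> L" using sL zero_le_square[of "real s"] by linarith
    moreover have "log 2 (2 ^ 2) \<le> log 2 L" using \<open>4 \<le> L\<close> by (subst log_le_cancel_iff) auto
    then have "2 \<le> log 2 L" by (simp only: log_nat_power) simp
    with \<open>real s \<le> sqrt L\<close> have "real s * 2 \<le> sqrt L * log 2 L" using L by (intro mult_mono) auto
    ultimately show ?thesis by simp
  qed
  then show ?thesis by (simp add: L_def add.commute)
qed

theorem theorem3:
  fixes k :: nat
  assumes "k \<ge> 3"
  shows "log 2 (real (bl k) + 1) \<le> real (\<beta> k) \<and>
         real (\<beta> k) \<le> min (20 * sqrt (log 2 (real k)) * log 2 (log 2 (real k))) (real (bl k) + 1)"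
proof -
  have k: "0 < k" using assms by simp
  obtain s where s: "2 ^ (s * s + 4 * s) \<le> k" "k < 2 ^ (s * s + 6 * s + 5)"
    using sqrt_scale_exists[OF k] by blast
  have "real (\<beta> k) \<le> real (8 * s + 5)"
    using beta_le[OF realizable_sqrt[OF s] k] by simp
  also have "\<dots> \<le> 20 * sqrt (log 2 (real k)) * log 2 (log 2 (real k))"
    by (rule sqrt_log_bound[OF assms s(1)])
  finally have 1: "real (\<beta> k) \<le> 20 * sqrt (log 2 (real k)) * log 2 (log 2 (real k))" .
  have 2: "real (\<beta> k) \<le> real (bl k) + 1"
    using beta_le[OF realizable_bl[OF k] k] by simp
  have "real (bl k + 1) \<le> real (2 ^ \<beta> k)"
    using bl_le_beta[OF realizable_bl[OF k] k] by (simp only: of_nat_le_iff)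
  then have "log 2 (real (bl k) + 1) \<le> real (\<beta> k)"
    by (subst log_le_iff) (auto simp: powr_realpow)
  with 1 2 show ?thesis by simp
qed

end
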